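(* There exist a compact minimal dynamical system $(Y,\mathbb Z,\sigma)$ all of whose motions are Bohr almost periodic and a function $F\in C(Y\times\mathbb R,\mathbb R)$ such that the scalar difference equation $$u(t+1)=F(\sigma(t,y),u(t))\qquad (t\in\mathbb Z_+,\ y\in Y)$$ has the following properties: the cocycle $\langle\mathbb R,\varphi,(Y,\mathbb Z,\sigma)\rangle$ that it generates is compact dissipative, and the corresponding skew-product dynamical system $(X,\mathbb Z_+,\pi)$, $X=\mathbb R\times Y$, $\pi=(\varphi,\sigma)$, has no almost periodic motion; that is, the equation is a one-dimensional almost periodic dissipative difference equation without almost periodic solutions.
   Context: A dynamical system $(X,\mathbb T,\pi)$ with $\mathbb T\in\{\mathbb Z,\mathbb Z_+\}$ on a metric space $(X,\rho)$ is a continuous map $\pi:\mathbb T\times X\to X$ with $\pi(0,x)=x$ and $\pi(s,\pi(t,x))=\pi(s+t,x)$. The motion through $x$ is the map $\pi(\cdot,x):\mathbb T\to X$. The system is minimal if $X$ contains no proper nonempty closed positively invariant subset. A point $x$ (equivalently its motion) is (Bohr) almost periodic if for every $\varepsilon>0$ there is $l>0$ such that every segment of length $l$ in $\mathbb T$ contains a number $\tau$ with $\rho(\pi(\tau+t,x),\pi(t,x))<\varepsilon$ for all $t\in\mathbb T$. For $u\in\mathbb R$, $y\in Y$, $\varphi(t,u,y)$ ($t\in\mathbb Z_+$) denotes the solution of the equation with $\varphi(0,u,y)=u$. It satisfies the cocycle identity $\varphi(t+\tau,u,y)=\varphi(\tau,\varphi(t,u,y),\sigma(t,y))$. The skew-product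 system is $\pi(t,(u,y))=(\varphi(t,u,y),\sigma(t,y))$. The cocycle is compact dissipative if there is a nonempty compact set $K\subseteq\mathbb R$ such that $\lim_{t\to+\infty}\sup_{y\in Y}\beta(\varphi(t,M,y),K)=0$ for every compact $M\subseteq\mathbb R$, where $\beta(A,B)=\sup_{a\in A}\inf_{b\in B}|a-b|$. *)

theory Defs
  imports "HOL-Analysis.Analysis"
begin

text \<open>
  The time semigroup is a type: \<open>int\<close> for \<open>\<int>\<close>, \<open>nat\<close> for the nonnegative integers. Both carry the
  discrete topology. Phase spaces are subsets \<open>X\<close> of a metric type, with its metric. Since HOL
  cannot quantify existentially over types, a compact metric space whose existence is claimed
  is taken inside \<open>nat \<Rightarrow> real\<close> with its (product) metric. Every compact metric space is
  homeomorphic to a compact subset of this space, and on compact spaces minimality and almost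
  periodicity depend only on the topology.
\<close>

definition dynamical_system ::
    "'x::metric_space set \<Rightarrow> ('t::{linordered_semidom,topological_space} \<Rightarrow> 'x \<Rightarrow> 'x) \<Rightarrow> bool" where
  "dynamical_system X \<pi> \<longleftrightarrow>
     (\<forall>t. \<forall>x\<in>X. \<pi> t x \<in> X) \<and>
     continuous_on (UNIV \<times> X) (\<lambda>(t, x). \<pi> t x) \<and>
     (\<forall>x\<in>X. \<pi> 0 x = x) \<and>
     (\<forall>s t. \<forall>x\<in>X. \<pi> s (\<pi> t x) = \<pi> (s + t) x)"

definition positively_invariant ::
    "('t::linordered_semidom \<Rightarrow> 'x \<Rightarrow> 'x) \<Rightarrow> 'x set \<Rightarrow> bool" where
  "positively_invariant \<pi> A \<longleftrightarrow> (\<forall>t\<ge>0. \<pi> t ` A \<subseteq> A)"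

definition minimal_system ::
    "'x::metric_space set \<Rightarrow> ('t::linordered_semidom \<Rightarrow> 'x \<Rightarrow> 'x) \<Rightarrow> bool" where
  "minimal_system X \<pi> \<longleftrightarrow>
     \<not> (\<exists>A. A \<subset> X \<and> A \<noteq> {} \<and> closedin (top_of_set X) A \<and> positively_invariant \<pi> A)"

definition almost_periodic_point ::
    "('t::linordered_semidom \<Rightarrow> 'x::metric_space \<Rightarrow> 'x) \<Rightarrow> 'x \<Rightarrow> bool" where
  "almost_periodic_point \<pi> x \<longleftrightarrow>
     (\<forall>\<epsilon>>0. \<exists>l>0. \<forall>a. \<exists>\<tau>\<in>{a..a + l}. \<forall>t. dist (\<pi> (\<tau> + t) x) (\<pi> t x) < \<epsilon>)"

text \<open>The solution of \<open>u(t+1) = F(\<sigma>(t,y), u(t))\<close>, \<open>u(0) = u\<close>.\<close>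

primrec solution ::
    "('y \<times> real \<Rightarrow> real) \<Rightarrow> (int \<Rightarrow> 'y \<Rightarrow> 'y) \<Rightarrow> nat \<Rightarrow> real \<Rightarrow> 'y \<Rightarrow> real" where
  "solution F \<sigma> 0 u y = u"
| "solution F \<sigma> (Suc t) u y = F (\<sigma> (int t) y, solution F \<sigma> t u y)"

definition skew_product ::
    "(nat \<Rightarrow> real \<Rightarrow> 'y \<Rightarrow> real) \<Rightarrow> (int \<Rightarrow> 'y \<Rightarrow> 'y) \<Rightarrow> nat \<Rightarrow> real \<times> 'y \<Rightarrow> real \<times> 'y" where
  "skew_product \<phi> \<sigma> t = (\<lambda>(u, y). (\<phi> t u y, \<sigma> (int t) y))"

text \<open>
  Suprema and infima are taken in \<open>ennreal\<close>, so that they are meaningful without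
  boundedness side conditions, and the supremum over the empty set is \<open>0\<close>.
\<close>

definition semidistance :: "real set \<Rightarrow> real set \<Rightarrow> ennreal" where
  "semidistance A B = (SUP a\<in>A. INF b\<in>B. ennreal \<bar>a - b\<bar>)"

definition compact_dissipative ::
    "'y set \<Rightarrow> (nat \<Rightarrow> real \<Rightarrow> 'y \<Rightarrow> real) \<Rightarrow> bool" where
  "compact_dissipative Y \<phi> \<longleftrightarrow>
     (\<exists>K. K \<noteq> {} \<and> compact K \<and>
       (\<forall>M. compact M \<longrightarrow>
         (\<lambda>t. SUP y\<in>Y. semidistance ((\<lambda>u. \<phi> t u y) ` M) K) \<longlonglongrightarrow> 0))"

lemma solution_cocycle:
  assumes "dynamical_system Y \<sigma>" "y \<in> Y"
  shows "solution F \<sigma> (t + \<tau>) u y = solution F \<sigma> \<tau> (solution F \<sigma> t u y) (\<sigma> (int t) y)"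
  using assms by (induction \<tau>) (auto simp: dynamical_system_def add.commute)

lemma skew_product_dynamical_system:
  fixes Y :: "'y::metric_space set" and \<sigma> :: "int \<Rightarrow> 'y \<Rightarrow> 'y"
  assumes \<sigma>: "dynamical_system Y \<sigma>" and F: "continuous_on (Y \<times> UNIV) F"
  shows "dynamical_system (UNIV \<times> Y) (skew_product (solution F \<sigma>) \<sigma>)"
proof -
  have inY: "\<sigma> t y \<in> Y" if "y \<in> Y" for t y
    using \<sigma> that by (simp add: dynamical_system_def)
  have cont_\<sigma>: "continuous_on Y (\<sigma> s)" for s
  proof -
    have "continuous_on (UNIV \<times> Y) (\<lambda>(t, x). \<sigma> t x)"
      using \<sigma> by (simp add: dynamical_system_def)
    then have "continuous_on Y (\<lambda>y. (\<lambda>(t, x). \<sigma> t x) (s, y))"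
      by (rule continuous_on_compose2) (auto intro!: continuous_intros)
    then show ?thesis by simp
  qed
  have cont_snd: "continuous_on (UNIV \<times> Y) (\<lambda>x::real \<times> 'y. \<sigma> s (snd x))" for s
    by (rule continuous_on_compose2[OF cont_\<sigma>[of s]]) (auto intro!: continuous_intros)
  have cont_sol: "continuous_on (UNIV \<times> Y) (\<lambda>x. solution F \<sigma> t (fst x) (snd x))" for t
  proof (induction t)
    case 0
    show ?case by (auto intro!: continuous_intros)
  next
    case (Suc t)
    show ?case
      by (simp, rule continuous_on_compose2[OF F])
        (auto intro!: continuous_on_Pair Suc cont_snd inY)
  qed
  let ?\<pi> = "skew_product (solution F \<sigma>) \<sigma>"
  have cont_t: "continuous_on (UNIV \<times> Y) (?\<pi> t)" for t
    unfolding skew_product_def case_prod_unfold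
    by (intro continuous_on_Pair cont_sol cont_snd)
  have each: "continuous_on ({t} \<times> (UNIV \<times> Y)) (\<lambda>(t, x). ?\<pi> t x)" for t
  proof -
    have "continuous_on ({t} \<times> (UNIV \<times> Y)) (\<lambda>z. ?\<pi> t (snd z))"
      by (rule continuous_on_compose2[OF cont_t[of t]]) (auto intro!: continuous_intros)
    then show ?thesis
      by (rule continuous_on_eq) auto
  qed
  have "continuous_on (\<Union>t. {t} \<times> (UNIV \<times> Y)) (\<lambda>(t, x). ?\<pi> t x)"
  proof (subst continuous_on_eq_continuous_within, safe)
    fix t :: nat and u :: real and y assume y: "y \<in> Y"
    have eq: "(\<Union>t. {t} \<times> (UNIV \<times> Y)) \<inter> ({t} \<times> UNIV) = {t} \<times> ((UNIV::real set) \<times> Y)" by auto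
    have "continuous (at (t, u, y) within {t} \<times> (UNIV \<times> Y)) (\<lambda>(t, x). ?\<pi> t x)"
      using each[of t] y by (auto simp: continuous_on_eq_continuous_within)
    moreover have "open ({t} \<times> (UNIV :: (real \<times> 'y) set))"
      by (intro open_Times) (auto simp: open_discrete)
    ultimately show "continuous (at (t, u, y) within (\<Union>t. {t} \<times> (UNIV \<times> Y))) (\<lambda>(t, x). ?\<pi> t x)"
      unfolding continuous_within
      by (subst at_within_nhd[of _ "{t} \<times> UNIV" _ "{t} \<times> (UNIV \<times> Y)"]) auto
  qed
  moreover have "(\<Union>t. {t} \<times> (UNIV \<times> Y)) = (UNIV :: nat set) \<times> ((UNIV :: real set) \<times> Y)" by auto
  moreover have "\<sigma> (int s) (\<sigma> (int t) y) = \<sigma> (int (s + t)) y" if "y \<in> Y" for s t y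
    using \<sigma> that by (simp add: dynamical_system_def)
  moreover have "\<sigma> 0 y = y" if "y \<in> Y" for y
    using \<sigma> that by (simp add: dynamical_system_def)
  moreover have "solution F \<sigma> s (solution F \<sigma> t u y) (\<sigma> (int t) y) = solution F \<sigma> (s + t) u y"
    if "y \<in> Y" for s t u y
    using solution_cocycle[OF \<sigma> that, of F t s u] by (simp add: add.commute)
  ultimately show ?thesis
    unfolding dynamical_system_def
    by (intro conjI allI ballI) (simp_all add: skew_product_def inY mem_Times_iff case_prod_unfold)
qed

end

theory Submission
  imports Defs
begin

text \<open>
  The base is the 2-adic odometer \<open>y \<mapsto> y + 1\<close> on the compact group of 2-adic integers. Let
  \<open>h y = (- 1) ^ v y\<close>, where \<open>v\<close> is the 2-adic valuation; along the positive integers this is the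
  period doubling sequence. The function \<open>h\<close> is locally constant except at \<open>0\<close>, where it has no limit.
  The series \<open>code y = (\<Sum>k\<ge>1. h (y + k) / 3 ^ k)\<close> codes the future \<open>h (y + 1), h (y + 2), \<dots>\<close> by a
  number in \<open>[-1/2, 1/2]\<close>, and shifting the future gives \<open>code (y + 1) = 3 code y - h (y + 1)\<close>.
  So \<open>code\<close> is a bounded invariant section of \<open>u \<mapsto> 3 u - h (y + 1)\<close>; the jumps of \<open>h\<close> make it
  discontinuous.

  This equation has a right-hand side that is neither bounded nor continuous at \<open>y = - 1\<close>. Both
  defects disappear when it is clamped to the interval of radius \<open>3 ^ (- v (y + 1))\<close> around
  \<open>code 0\<close>, which shrinks to a point as \<open>y \<rightarrow> - 1\<close>. The section survives: if \<open>z = y + 1\<close> is divisible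
  by \<open>2 ^ n\<close>, then \<open>h (z + j) = h j\<close> for \<open>1 \<le> j < 2 ^ n\<close>, in particular for \<open>1 \<le> j \<le> n\<close>, so the codes
  of \<open>z\<close> and \<open>0\<close> differ by at most \<open>3 ^ (- n)\<close> (\<open>code_near_zero\<close>). The clamped
  right-hand side has values in a fixed bounded interval, which gives dissipativity.

  The clamping also forces every motion through one and the same point asymptotically. The base orbit
  of any \<open>y\<close> returns to \<open>0\<close> arbitrarily closely, and each time the solution is squeezed to
  \<open>code 0\<close>. Hence the motion of \<open>(code 0, 0)\<close> is a pointwise limit of tails of any given motion and
  inherits its almost periods up to a limit in the inequality. On that limit motion the first component is
  \<open>code t\<close> at time \<open>t\<close>, and two codes less than \<open>1/3\<close> apart have the same first symbol. An almost period
  \<open>\<tau> > 0\<close> of the motion, for small \<open>\<epsilon>\<close>, would thus be an exact period of \<open>h\<close> on the positive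
  integers, which is impossible as \<open>h (2 \<tau>) = - h \<tau>\<close> (\<open>parity_double\<close>).
\<close>

section \<open>The 2-adic odometer\<close>

text \<open>
  The 2-adic integers as the inverse limit of the rings \<open>\<int> / 2 ^ n\<close>: \<open>y n\<close> stands for the residue
  modulo \<open>2 ^ n\<close> in \<open>{0..<2 ^ n}\<close>. The equation at \<open>n\<close> both makes \<open>y n\<close> such a residue and makes it
  compatible with \<open>y (Suc n)\<close>.
\<close>

definition dyadic :: "(nat \<Rightarrow> real) set" where
  "dyadic = {y. \<forall>n. y n = of_int (\<lfloor>y (Suc n)\<rfloor> mod 2 ^ n)}"

definition add_int :: "int \<Rightarrow> (nat \<Rightarrow> real) \<Rightarrow> nat \<Rightarrow> real" where
  "add_int t y = (\<lambda>n. of_int ((\<lfloor>y n\<rfloor> + t) mod 2 ^ n))"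

definition zero :: "nat \<Rightarrow> real" where
  "zero = (\<lambda>n. 0)"

lemma zero_dyadic [simp]: "zero \<in> dyadic"
  by (simp add: dyadic_def zero_def)

lemma dyadic_Suc: "y \<in> dyadic \<Longrightarrow> y n = of_int (\<lfloor>y (Suc n)\<rfloor> mod 2 ^ n)"
  unfolding dyadic_def by blast

lemma dyadic_Ints: "y \<in> dyadic \<Longrightarrow> y n \<in> \<int>"
  using dyadic_Suc[of y n] by (metis Ints_of_int)

lemma dyadic_residue:
  assumes "y \<in> dyadic" "m \<le> n"
  shows "y m = of_int (\<lfloor>y n\<rfloor> mod 2 ^ m)"
  using assms(2)
proof (induction n rule: dec_induct)
  case base
  show ?case
    using dyadic_Suc[OF assms(1), of m] by (metis floor_of_int mod_mod_trivial)
next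
  case (step n)
  have "\<lfloor>y n\<rfloor> = \<lfloor>y (Suc n)\<rfloor> mod 2 ^ n"
    using dyadic_Suc[OF assms(1), of n] by (metis floor_of_int)
  then show ?case
    using step by (simp add: mod_mod_cancel le_imp_power_dvd)
qed

lemma dyadic_agree:
  assumes "y \<in> dyadic" "z \<in> dyadic" "y n = z n" "m \<le> n"
  shows "y m = z m"
  using dyadic_residue[OF assms(1,4)] dyadic_residue[OF assms(2,4)] assms(3) by simp

lemma dyadic_range:
  assumes "y \<in> dyadic"
  shows "y n \<in> {0..2 ^ n}"
proof -
  obtain a :: int where a: "y n = of_int (a mod 2 ^ n)"
    using dyadic_residue[OF assms order_refl] by blast
  have "0 \<le> a mod 2 ^ n" "a mod 2 ^ n \<le> 2 ^ n"
    by (simp_all add: less_imp_le)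
  then show ?thesis
    unfolding a by simp
qed

text \<open>
  The condition that relates \<open>y n\<close> to \<open>y (Suc n)\<close> restricts this pair to a finite set, so it is closed
  although it involves the floor function. Compactness then comes from Tychonoff's theorem.
\<close>

lemma compact_dyadic: "compact dyadic"
proof -
  define D :: "nat \<Rightarrow> (real \<times> real) set" where
    "D n = (\<lambda>a::int. (of_int (a mod 2 ^ n), of_int a)) ` {0..2 ^ Suc n}" for n
  have eq: "dyadic = (\<Inter>n. (\<lambda>y. (y n, y (Suc n))) -` D n)"
  proof (intro set_eqI iffI)
    fix y assume y: "y \<in> dyadic"
    show "y \<in> (\<Inter>n. (\<lambda>y. (y n, y (Suc n))) -` D n)"
    proof (intro InterI, clarify, intro vimageI2)
      fix n
      have "of_int \<lfloor>y (Suc n)\<rfloor> = y (Suc n)"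
        using dyadic_Ints[OF y, of "Suc n"] by (simp add: of_int_floor)
      moreover have "y n = of_int (\<lfloor>y (Suc n)\<rfloor> mod 2 ^ n)"
        using y by (rule dyadic_Suc)
      moreover have "\<lfloor>y (Suc n)\<rfloor> \<in> {0..2 ^ Suc n}"
        using dyadic_range[OF y, of "Suc n"] by (auto simp: floor_le_iff)
      ultimately show "(y n, y (Suc n)) \<in> D n"
        unfolding D_def by (intro image_eqI[of _ _ "\<lfloor>y (Suc n)\<rfloor>"]) (simp_all only:)
    qed
  next
    fix y assume "y \<in> (\<Inter>n. (\<lambda>y. (y n, y (Suc n))) -` D n)"
    then have D: "(y n, y (Suc n)) \<in> D n" for n by blast
    have "y n = of_int (\<lfloor>y (Suc n)\<rfloor> mod 2 ^ n)" for n
      using D[of n] unfolding D_def by (elim imageE) (simp only: prod.inject floor_of_int)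
    then show "y \<in> dyadic" unfolding dyadic_def by blast
  qed
  have "closed ((\<lambda>y::nat \<Rightarrow> real. (y n, y (Suc n))) -` D n)" for n
    by (intro closed_vimage finite_imp_closed continuous_intros continuous_on_product_coordinates)
      (simp add: D_def)
  then have "closed dyadic" unfolding eq by (intro closed_INT ballI)
  moreover have "compact (Pi\<^sub>E UNIV (\<lambda>n. {0..2 ^ n::real}))"
    unfolding compactin_euclidean_iff[symmetric] euclidean_product_topology[symmetric] compactin_PiE
    by simp
  moreover have "dyadic \<subseteq> Pi\<^sub>E UNIV (\<lambda>n. {0..2 ^ n::real})"
    using dyadic_range by (auto simp: PiE_def Pi_def)
  ultimately show ?thesis
    by (metis closed_Int_compact inf.absorb1)
qed

lemma add_int_dyadic [simp]:
  assumes y: "y \<in> dyadic"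
  shows "add_int t y \<in> dyadic"
proof -
  have "(\<lfloor>y n\<rfloor> + t) mod 2 ^ n = (\<lfloor>y (Suc n)\<rfloor> + t) mod 2 ^ Suc n mod 2 ^ n" for n
  proof -
    have "\<lfloor>y n\<rfloor> = \<lfloor>y (Suc n)\<rfloor> mod 2 ^ n"
      using dyadic_residue[OF y, of n "Suc n"] by simp
    moreover have "(2::int) ^ n dvd 2 ^ Suc n" by simp
    ultimately show ?thesis by (simp only: mod_mod_cancel mod_add_left_eq)
  qed
  then show ?thesis
    unfolding dyadic_def add_int_def floor_of_int mem_Collect_eq of_int_eq_iff by (rule allI)
qed

lemma add_int_add: "add_int s (add_int t y) = add_int (s + t) y"
  unfolding add_int_def floor_of_int mod_add_left_eq by (simp add: add_ac)

lemma add_int_0: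
  assumes "y \<in> dyadic"
  shows "add_int 0 y = y"
proof
  show "add_int 0 y n = y n" for n
    unfolding add_int_def add_0_right by (rule dyadic_residue[OF assms order_refl, symmetric])
qed

text \<open>Residues are locally constant, since distinct integers are at distance at least \<open>1\<close>.\<close>

lemma eventually_residue_eq:
  assumes "(f \<longlongrightarrow> z) F" "z \<in> dyadic" "\<forall>\<^sub>F x in F. f x \<in> dyadic"
  shows "\<forall>\<^sub>F x in F. f x n = z n"
proof -
  have "((\<lambda>x. f x n) \<longlongrightarrow> z n) F"
    using assms(1) by (rule continuous_on_tendsto_compose[OF continuous_on_product_coordinates[of n]]) auto
  then have "\<forall>\<^sub>F x in F. dist (f x n) (z n) < 1"
    by (auto simp: tendsto_iff)
  with assms(3) show ?thesis
  proof eventually_elim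
    case (elim x)
    obtain a b :: int where "f x n = a" "z n = b"
      using dyadic_Ints[OF elim(1), of n] dyadic_Ints[OF assms(2), of n] by (auto elim!: Ints_cases)
    with elim(2) have "\<bar>a - b\<bar> < 1"
      by (simp add: dist_real_def)
    with \<open>f x n = a\<close> \<open>z n = b\<close> show ?case by simp
  qed
qed

text \<open>
  The metric is a weighted sum over coordinates, and a residue modulo \<open>2 ^ n\<close> determines the residues
  modulo all smaller powers, so a single residue of high level controls the distance.
\<close>

lemma dist_less_if_residue_eq:
  fixes e :: real
  assumes "e > 0"
  obtains n where "\<And>y z. y \<in> dyadic \<Longrightarrow> z \<in> dyadic \<Longrightarrow> y n = z n \<Longrightarrow> dist y z < e"
proof -
  obtain N where N: "(1/2) ^ N < e"
    using real_arch_pow_inv[OF assms, of "1/2"] by auto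
  obtain n where n: "\<And>k. k \<le> N \<Longrightarrow> (from_nat k :: nat) \<le> n"
    using finite_imageI[OF finite_atMost[of N], of "from_nat :: nat \<Rightarrow> nat"]
    unfolding finite_nat_set_iff_bounded_le by auto
  show thesis
  proof
    fix y z assume "y \<in> dyadic" "z \<in> dyadic" "y n = z n"
    then have "dist (y (from_nat k)) (z (from_nat k)) = 0" if "k \<le> N" for k
      using dyadic_agree n that by (metis dist_self)
    then have "{dist (y (from_nat k)) (z (from_nat k)) |k. k \<le> N} = (\<lambda>k. 0) ` {..N}"
      unfolding setcompr_eq_image by (intro image_cong) auto
    then have "{dist (y (from_nat k)) (z (from_nat k)) |k. k \<le> N} = {0}"
      by auto
    then show "dist y z < e"
      using dist_fun_le_dist_first_terms[of y z N] N by simp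
  qed
qed

lemma dynamical_system_dyadic: "dynamical_system dyadic add_int"
proof -
  have "continuous_on (UNIV \<times> dyadic) (\<lambda>p. add_int (fst p) (snd p))"
  proof (rule continuous_on_coordinatewise_then_product)
    fix n
    show "continuous_on (UNIV \<times> dyadic) (\<lambda>p. add_int (fst p) (snd p) n)"
      unfolding continuous_on_def
    proof
      fix p :: "int \<times> (nat \<Rightarrow> real)" assume p: "p \<in> UNIV \<times> dyadic"
      let ?W = "at p within UNIV \<times> dyadic"
      have "(snd \<longlongrightarrow> snd p) ?W" "(fst \<longlongrightarrow> fst p) ?W"
        by (auto intro!: tendsto_intros)
      moreover have "\<forall>\<^sub>F q in ?W. snd q \<in> dyadic"
        by (auto simp: eventually_at_filter mem_Times_iff)
      ultimately have "\<forall>\<^sub>F q in ?W. snd q n = snd p n" "\<forall>\<^sub>F q in ?W. fst q = fst p"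
        using p by (auto simp: tendsto_discrete intro!: eventually_residue_eq)
      then have "\<forall>\<^sub>F q in ?W. add_int (fst p) (snd p) n = add_int (fst q) (snd q) n"
        by eventually_elim (simp add: add_int_def)
      then show "((\<lambda>q. add_int (fst q) (snd q) n) \<longlongrightarrow> add_int (fst p) (snd p) n) ?W"
        by (rule Lim_transform_eventually[OF tendsto_const])
    qed
  qed
  then show ?thesis
    by (simp add: dynamical_system_def add_int_add add_int_0 case_prod_unfold)
qed

text \<open>
  Every forward orbit is dense: adding the right nonnegative integer gives \<open>a\<close> any prescribed residue
  modulo \<open>2 ^ n\<close>.
\<close>

lemma minimal_system_dyadic: "minimal_system dyadic add_int"
  unfolding minimal_system_def
proof (rule notI, elim exE conjE)
  fix A
  assume A: "closedin (top_of_set dyadic) A" "positively_invariant add_int A"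
    and sub: "A \<subset> dyadic" and "A \<noteq> {}"
  then obtain a where a: "a \<in> A" by blast
  have "y \<in> A" if y: "y \<in> dyadic" for y
  proof -
    have "closed A"
      using A(1) compact_dyadic by (auto intro: closedin_closed_trans compact_imp_closed)
    moreover have "y \<in> closure A"
      unfolding closure_approachable
    proof safe
      fix e :: real assume "e > 0"
      then obtain n where n: "\<And>y z. y \<in> dyadic \<Longrightarrow> z \<in> dyadic \<Longrightarrow> y n = z n \<Longrightarrow> dist y z < e"
        using dist_less_if_residue_eq by blast
      define t where "t = (\<lfloor>y n\<rfloor> - \<lfloor>a n\<rfloor>) mod 2 ^ n"
      have "t \<ge> 0" by (simp add: t_def)
      then have "add_int t a \<in> A"
        using A(2) a by (auto simp: positively_invariant_def)
      moreover have "add_int t a n = y n"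
        using dyadic_residue[OF y order_refl, symmetric] by (simp add: add_int_def t_def mod_simps)
      then have "dist (add_int t a) y < e"
        using n a sub y by (meson add_int_dyadic psubsetD)
      ultimately show "\<exists>x\<in>A. dist x y < e" by blast
    qed
    ultimately show ?thesis by (simp add: closure_closed)
  qed
  then show False using sub by auto
qed

text \<open>
  All multiples of \<open>2 ^ n\<close> are almost periods, because adding them does not change residues modulo
  \<open>2 ^ n\<close>.
\<close>

lemma almost_periodic_point_dyadic:
  assumes "y \<in> dyadic"
  shows "almost_periodic_point add_int y"
  unfolding almost_periodic_point_def
proof (intro allI impI)
  fix e :: real assume "e > 0"
  then obtain n where n: "\<And>y z. y \<in> dyadic \<Longrightarrow> z \<in> dyadic \<Longrightarrow> y n = z n \<Longrightarrow> dist y z < e"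
    using dist_less_if_residue_eq by blast
  show "\<exists>l>0. \<forall>a. \<exists>\<tau>\<in>{a..a + l}. \<forall>t. dist (add_int (\<tau> + t) y) (add_int t y) < e"
  proof (intro exI[of _ "2 ^ n"] conjI allI)
    fix a :: int
    define \<tau> where "\<tau> = a + (- a) mod 2 ^ n"
    have "\<tau> mod 2 ^ n = 0" by (simp add: \<tau>_def mod_simps)
    have "add_int (\<tau> + t) y n = add_int t y n" for t
    proof -
      have "(\<lfloor>y n\<rfloor> + (\<tau> + t)) mod 2 ^ n = (\<lfloor>y n\<rfloor> + t + \<tau> mod 2 ^ n) mod 2 ^ n"
        unfolding mod_add_right_eq by (simp add: add_ac)
      then show ?thesis using \<open>\<tau> mod 2 ^ n = 0\<close> by (simp add: add_int_def)
    qed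
    then have "\<forall>t. dist (add_int (\<tau> + t) y) (add_int t y) < e"
      using n assms by simp
    moreover have "\<tau> \<in> {a..a + 2 ^ n}"
      by (simp add: \<tau>_def less_imp_le)
    ultimately show "\<exists>\<tau>\<in>{a..a + 2 ^ n}. \<forall>t. dist (add_int (\<tau> + t) y) (add_int t y) < e"
      by blast
  qed simp
qed

section \<open>The 2-adic valuation\<close>

text \<open>
  The search starts at \<open>y 1\<close> since \<open>y 0\<close>, a residue modulo \<open>1\<close>, is always \<open>0\<close>; thus for nonzero \<open>y\<close>
  it yields the largest \<open>n\<close> with \<open>y n = 0\<close>. At \<open>zero\<close> the value is unspecified.
\<close>

definition val :: "(nat \<Rightarrow> real) \<Rightarrow> nat" where
  "val y = (LEAST n. y (Suc n) \<noteq> 0)"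

definition parity :: "(nat \<Rightarrow> real) \<Rightarrow> real" where
  "parity y = (- 1) ^ val y"

text \<open>
  A power of the 2-adic absolute value. The base \<open>1/3\<close> matches the expansion rate of the
  equation below, which makes \<open>radius\<close> bound the oscillation of \<open>code\<close> at \<open>zero\<close>.
\<close>

definition radius :: "(nat \<Rightarrow> real) \<Rightarrow> real" where
  "radius y = (if y = zero then 0 else (1/3) ^ val y)"

lemma parity_cases: "parity y = 1 \<or> parity y = - 1"
  by (simp add: parity_def minus_one_power_iff)

lemma radius_nonneg: "0 \<le> radius y" and radius_le_1: "radius y \<le> 1"
  by (simp_all add: radius_def power_le_one)

lemma residue_0: "y \<in> dyadic \<Longrightarrow> y 0 = 0"
  using dyadic_Suc[of y 0] by simp

lemma val_nonzero:
  assumes "y \<in> dyadic" "y \<noteq> zero"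
  shows "y (Suc (val y)) \<noteq> 0"
proof -
  obtain n where "y n \<noteq> 0" using assms(2) by (auto simp: zero_def)
  then have "\<exists>n. y (Suc n) \<noteq> 0" using residue_0[OF assms(1)] by (cases n) auto
  then show ?thesis unfolding val_def by (rule LeastI_ex)
qed

lemma residue_val: "y \<in> dyadic \<Longrightarrow> y (val y) = 0"
proof (cases "val y")
  case (Suc m)
  then show ?thesis using not_less_Least[of m "\<lambda>n. y (Suc n) \<noteq> 0"] by (simp add: val_def)
qed (simp add: residue_0)

lemma radius_le:
  assumes "y \<in> dyadic" "y n = 0"
  shows "radius y \<le> (1/3) ^ n"
proof (cases "y = zero")
  case False
  have "n \<le> val y"
  proof (rule ccontr)
    assume "\<not> n \<le> val y"
    then have "y (Suc (val y)) = 0"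
      using dyadic_agree[OF assms(1) zero_dyadic, of n "Suc (val y)"] assms(2)
      by (simp add: zero_def)
    then show False using val_nonzero assms False by blast
  qed
  then show ?thesis using False by (simp add: radius_def power_decreasing)
qed (simp add: radius_def)

text \<open>
  The valuation is locally constant away from \<open>zero\<close>: a nonzero residue already determines it.
\<close>

lemma val_eq:
  assumes "y \<in> dyadic" "z \<in> dyadic" "y n = z n" "y n \<noteq> 0"
  shows "val y = val z"
proof -
  obtain k where k: "n = Suc k" using residue_0[OF assms(1)] assms(4) by (cases n) auto
  have eq: "y m = z m" if "m \<le> n" for m
    using dyadic_agree assms that by blast
  have le: "val y \<le> k" "val z \<le> k"
    unfolding val_def using assms(3,4) k by (auto intro!: Least_le)
  have "y \<noteq> zero" "z \<noteq> zero" using assms(3,4) by (auto simp: zero_def)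
  then have "y (Suc (val y)) \<noteq> 0" "z (Suc (val z)) \<noteq> 0"
    using val_nonzero assms(1,2) by blast+
  then have "z (Suc (val y)) \<noteq> 0" "y (Suc (val z)) \<noteq> 0"
    using eq le k by simp_all
  then show ?thesis by (auto simp: val_def intro!: antisym Least_le)
qed

text \<open>
  Doubling raises the valuation by one. For this reason no positive integer is a period of \<open>parity\<close>
  on the positive integers.
\<close>

lemma parity_double:
  assumes "t > 0"
  shows "parity (add_int (2 * t) zero) = - parity (add_int t zero)"
proof -
  have dbl: "add_int (2 * t) zero (Suc n) = 2 * add_int t zero n" for n
    by (simp add: add_int_def zero_def mult_mod_right[symmetric])
  have "add_int t zero \<noteq> zero"
  proof
    assume "add_int t zero = zero"
    then have "t mod 2 ^ nat t = 0" by (simp add: add_int_def zero_def fun_eq_iff)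
    moreover have "t < 2 ^ nat t" using assms of_nat_less_two_power[of "nat t"] by simp
    ultimately show False using assms by simp
  qed
  then have "add_int t zero (Suc (val (add_int t zero))) \<noteq> 0"
    by (intro val_nonzero) simp_all
  then have "add_int (2 * t) zero (Suc (Suc (val (add_int t zero)))) \<noteq> 0"
    by (simp add: dbl)
  then have "val (add_int (2 * t) zero) = Suc (LEAST n. add_int (2 * t) zero (Suc (Suc n)) \<noteq> 0)"
    unfolding val_def by (rule Least_Suc) (simp add: dbl residue_0)
  then have "val (add_int (2 * t) zero) = Suc (val (add_int t zero))"
    by (simp add: dbl val_def)
  then show ?thesis by (simp add: parity_def)
qed

section \<open>A bounded invariant section\<close>

text \<open>
  The symbols \<open>parity (y + 1), parity (y + 2), \<dots>\<close> are the digits \<open>\<plusminus> 1\<close> of a ternary expansion. Base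
  \<open>3\<close> (rather than \<open>2\<close>) leaves gaps between numbers with different leading digits, so that the
  digits can be read off from approximate values.
\<close>

definition code :: "(nat \<Rightarrow> real) \<Rightarrow> real" where
  "code y = (\<Sum>k. parity (add_int (int k + 1) y) / 3 ^ Suc k)"

lemma code_summable: "summable (\<lambda>k. parity (add_int (int k + 1) y) / 3 ^ Suc k)"
proof (rule summable_comparison_test')
  show "summable (\<lambda>k. (1/3::real) ^ Suc k)"
    by (simp add: summable_geometric)
  show "norm (parity (add_int (int k + 1) y) / 3 ^ Suc k) \<le> (1/3) ^ Suc k" for k
    using parity_cases[of "add_int (int k + 1) y"] by (auto simp: power_divide)
qed

lemma code_shift: "code (add_int 1 y) = 3 * code y - parity (add_int 1 y)"
proof -
  have "(\<Sum>k. parity (add_int (int (Suc k) + 1) y) / 3 ^ Suc (Suc k))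
      = code y - parity (add_int 1 y) / 3"
    using suminf_split_head[OF code_summable[of y]] by (simp add: code_def)
  moreover have "(\<Sum>k. parity (add_int (int (Suc k) + 1) y) / 3 ^ Suc (Suc k))
      = (\<Sum>k. parity (add_int (int k + 1) (add_int 1 y)) / 3 ^ Suc k / 3)"
    by (simp add: add_int_add add_ac mult.commute)
  moreover have "\<dots> = code (add_int 1 y) / 3"
    unfolding code_def by (rule suminf_divide[OF code_summable])
  ultimately show ?thesis by simp
qed

lemma abs_code_le: "\<bar>code y\<bar> \<le> 1/2"
proof -
  have geo: "(\<lambda>k. (1/3::real) ^ Suc k) sums (1/2)"
    using sums_mult[OF geometric_sums[of "1/3::real"], of "1/3"] by simp
  have "norm (code y) \<le> (\<Sum>k. (1/3::real) ^ Suc k)"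
    unfolding code_def
  proof (rule norm_suminf_le)
    show "norm (parity (add_int (int k + 1) y) / 3 ^ Suc k) \<le> (1/3) ^ Suc k" for k
      using parity_cases[of "add_int (int k + 1) y"] by (auto simp: power_divide)
  qed (use geo in \<open>simp add: sums_iff\<close>)
  then show ?thesis using geo by (simp add: sums_iff)
qed

text \<open>
  The leading digit contributes \<open>\<plusminus> 1/3\<close> and the remaining ones at most \<open>1/6\<close> in absolute value, so
  codes with different leading digits are at least \<open>2/3 - 2/6\<close> apart.
\<close>

lemma code_separates:
  assumes "\<bar>code y - code z\<bar> < 1/3"
  shows "parity (add_int 1 y) = parity (add_int 1 z)"
  using parity_cases[of "add_int 1 y"] parity_cases[of "add_int 1 z"] assms
    code_shift[of y] code_shift[of z]
    abs_code_le[of "add_int 1 y"] abs_code_le[of "add_int 1 z"] by linarith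

lemma code_dist_le:
  assumes "\<And>j. 1 \<le> j \<Longrightarrow> j \<le> int m \<Longrightarrow> parity (add_int j y) = parity (add_int j z)"
  shows "\<bar>code y - code z\<bar> \<le> (1/3) ^ m"
  using assms
proof (induction m arbitrary: y z)
  case 0
  then show ?case using abs_code_le[of y] abs_code_le[of z] by simp
next
  case (Suc m)
  have "\<bar>code (add_int 1 y) - code (add_int 1 z)\<bar> \<le> (1/3) ^ m"
    using Suc.prems by (intro Suc.IH) (simp add: add_int_add)
  moreover have "parity (add_int 1 y) = parity (add_int 1 z)"
    using Suc.prems by simp
  ultimately have "\<bar>3 * code y - 3 * code z\<bar> \<le> (1/3) ^ m"
    by (simp add: code_shift)
  moreover have "(1/3::real) ^ Suc m = (1/3) ^ m / 3" by simp
  ultimately show ?case by linarith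
qed

text \<open>
  If \<open>y\<close> is divisible by \<open>2 ^ n\<close>, then \<open>y + j\<close> and \<open>j\<close> have the same valuation for \<open>1 \<le> j < 2 ^ n\<close>.
  As \<open>n < 2 ^ n\<close>, the codes of \<open>y\<close> and \<open>zero\<close> agree in the first \<open>n\<close> digits.
\<close>

lemma code_near_zero:
  assumes y: "y \<in> dyadic"
  shows "\<bar>code y - code zero\<bar> \<le> radius y"
proof (cases "y = zero")
  case False
  define n where "n = val y"
  have "\<bar>code y - code zero\<bar> \<le> (1/3) ^ n"
  proof (rule code_dist_le)
    fix j :: int assume j: "1 \<le> j" "j \<le> int n"
    have "j < 2 ^ n" using j of_nat_less_two_power[of n] by (smt (verit))
    have "y n = 0" using residue_val[OF y] by (simp add: n_def)
    then have "add_int j y n = j" "add_int j zero n = j"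
      using j \<open>j < 2 ^ n\<close> by (simp_all add: add_int_def zero_def)
    then show "parity (add_int j y) = parity (add_int j zero)"
      unfolding parity_def using y j by (subst val_eq[of _ "add_int j zero" n]) auto
  qed
  then show ?thesis using False by (simp add: radius_def n_def)
qed (simp add: radius_def)

section \<open>The equation\<close>

text \<open>
  The map \<open>u \<mapsto> 3 u - parity z\<close>, truncated to an interval that contains \<open>code z\<close> by
  \<open>code_near_zero\<close>. Over \<open>zero\<close> the interval is the single point \<open>code zero\<close>, which overrides the
  unspecified value \<open>parity zero\<close>. The argument \<open>z\<close> is the base point after the step, whence
  the shift by \<open>1\<close> in \<open>rhs\<close>.
\<close>

definition clamped :: "(nat \<Rightarrow> real) \<times> real \<Rightarrow> real" where
  "clamped = (\<lambda>(z, u). max (code zero - radius z) (min (code zero + radius z) (3 * u - parity z)))"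

definition rhs :: "(nat \<Rightarrow> real) \<times> real \<Rightarrow> real" where
  "rhs = (\<lambda>(y, u). clamped (add_int 1 y, u))"

lemma clamped_dist: "\<bar>clamped (z, u) - code zero\<bar> \<le> radius z"
  using radius_nonneg[of z] by (auto simp: clamped_def)

text \<open>
  Away from \<open>zero\<close> the functions \<open>radius\<close> and \<open>parity\<close> are locally constant; at \<open>zero\<close> the oscillation of
  \<open>parity\<close> is suppressed by \<open>radius\<close> tending to \<open>0\<close>.
\<close>

lemma continuous_on_clamped: "continuous_on (dyadic \<times> UNIV) clamped"
  unfolding continuous_on_def
proof
  fix p :: "(nat \<Rightarrow> real) \<times> real" assume p: "p \<in> dyadic \<times> UNIV"
  obtain z u where zu: "p = (z, u)" by fastforce
  with p have z: "z \<in> dyadic" by simp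
  let ?W = "at p within dyadic \<times> UNIV"
  have dy: "\<forall>\<^sub>F q in ?W. fst q \<in> dyadic"
    by (auto simp: eventually_at_filter mem_Times_iff)
  have "(fst \<longlongrightarrow> z) ?W"
    using tendsto_fst[OF tendsto_ident_at, of p] zu by simp
  then have near: "\<forall>\<^sub>F q in ?W. fst q n = z n" for n
    using z dy by (rule eventually_residue_eq)
  show "(clamped \<longlongrightarrow> clamped p) ?W"
  proof (cases "z = zero")
    case True
    have "((\<lambda>q. radius (fst q)) \<longlongrightarrow> 0) ?W"
      unfolding tendsto_iff
    proof safe
      fix e :: real assume "e > 0"
      then obtain n where n: "(1/3) ^ n < e"
        using real_arch_pow_inv[of e "1/3"] by auto
      show "\<forall>\<^sub>F q in ?W. dist (radius (fst q)) 0 < e"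
        using near[of n] dy
      proof eventually_elim
        case (elim q)
        then have "radius (fst q) \<le> (1/3) ^ n"
          by (intro radius_le) (simp_all add: True zero_def)
        then show ?case using n radius_nonneg[of "fst q"] by simp
      qed
    qed
    then have "((\<lambda>q. clamped q - code zero) \<longlongrightarrow> 0) ?W"
      by (rule Lim_null_comparison[rotated])
        (use clamped_dist in \<open>auto intro!: always_eventually\<close>)
    moreover have "clamped p = code zero"
      using clamped_dist[of z u] by (simp add: zu True radius_def)
    ultimately show ?thesis by (simp add: LIM_zero_iff)
  next
    case False
    define n where "n = Suc (val z)"
    have "z n \<noteq> 0" using val_nonzero z False by (simp add: n_def)
    have "\<forall>\<^sub>F q in ?W. max (code zero - radius z) (min (code zero + radius z) (3 * snd q - parity z))
            = clamped q"
      using near[of n] dy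
    proof eventually_elim
      case (elim q)
      then have "val (fst q) = val z"
        using z \<open>z n \<noteq> 0\<close> by (intro val_eq[of _ _ n]) auto
      moreover have "fst q \<noteq> zero" using elim \<open>z n \<noteq> 0\<close> by (auto simp: zero_def)
      ultimately show ?case
        using False by (simp add: clamped_def case_prod_unfold radius_def parity_def)
    qed
    moreover have "((\<lambda>q. max (code zero - radius z) (min (code zero + radius z) (3 * snd q - parity z)))
        \<longlongrightarrow> clamped p) ?W"
      unfolding clamped_def zu by (auto intro!: tendsto_eq_intros)
    ultimately show ?thesis by (rule Lim_transform_eventually[rotated])
  qed
qed

lemma continuous_on_rhs: "continuous_on (dyadic \<times> UNIV) rhs"
proof -
  have "continuous_on (UNIV \<times> dyadic) (\<lambda>(t, x). add_int t x)"
    using dynamical_system_dyadic by (simp add: dynamical_system_def)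
  then have "continuous_on (dyadic \<times> (UNIV::real set)) (\<lambda>p. (\<lambda>(t, x). add_int t x) (1, fst p))"
    by (rule continuous_on_compose2)
      (auto intro!: continuous_on_Pair continuous_on_const continuous_on_fst continuous_on_id)
  then have "continuous_on (dyadic \<times> (UNIV::real set)) (\<lambda>p. add_int 1 (fst p))"
    by simp
  then show ?thesis
    unfolding rhs_def case_prod_unfold
    by (intro continuous_on_compose2[OF continuous_on_clamped] continuous_on_Pair
        continuous_on_snd continuous_on_id) auto
qed

abbreviation phi :: "nat \<Rightarrow> real \<Rightarrow> (nat \<Rightarrow> real) \<Rightarrow> real" where
  "phi \<equiv> solution rhs add_int"

lemma phi_Suc: "phi (Suc t) u y = clamped (add_int (int t + 1) y, phi t u y)"
  by (simp add: rhs_def add_int_add add.commute)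

text \<open>
  The graph of \<open>code\<close> is invariant: on it the truncation has no effect, so the shift identity for \<open>code\<close> is
  exactly the equation.
\<close>

lemma phi_code:
  assumes "y \<in> dyadic"
  shows "phi t (code y) y = code (add_int (int t) y)"
proof (induction t)
  case 0
  then show ?case using assms by (simp add: add_int_0)
next
  case (Suc t)
  let ?z = "add_int (int t + 1) y"
  have "code ?z = 3 * code (add_int (int t) y) - parity ?z"
    using code_shift[of "add_int (int t) y"] by (simp add: add_int_add add.commute)
  moreover have "\<bar>code ?z - code zero\<bar> \<le> radius ?z"
    using assms by (intro code_near_zero) simp
  ultimately show ?case
    unfolding phi_Suc Suc clamped_def by (auto simp: add.commute)
qed

text \<open>
  After one step every solution lies in the interval of radius \<open>1\<close> around \<open>code zero\<close>.
\<close>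

lemma compact_dissipative_phi: "compact_dissipative dyadic phi"
proof -
  let ?K = "{code zero - 1..code zero + 1}"
  have "semidistance ((\<lambda>u. phi (Suc t) u y) ` M) ?K = 0" for t M y
  proof -
    have "(INF b\<in>?K. ennreal \<bar>phi (Suc t) u y - b\<bar>) \<le> 0" for u
    proof (rule INF_lower2)
      show "phi (Suc t) u y \<in> ?K"
        using clamped_dist[of "add_int (int t + 1) y" "phi t u y"]
          radius_le_1[of "add_int (int t + 1) y"]
        unfolding phi_Suc by auto
    qed simp
    then show ?thesis by (auto simp: semidistance_def intro!: SUP_eq_const antisym SUP_least)
  qed
  then have "(\<lambda>t. SUP y\<in>dyadic. semidistance ((\<lambda>u. phi t u y) ` M) ?K) \<longlonglongrightarrow> 0" for M
    by (subst filterlim_sequentially_Suc[symmetric])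
      (simp add: bot_ennreal[symmetric] del: solution.simps)
  then show ?thesis
    unfolding compact_dissipative_def
    by (intro exI[of _ ?K]) simp
qed

text \<open>
  The base orbit of \<open>y\<close> visits every neighbourhood of \<open>zero\<close>, where the solution is forced to be near
  \<open>code zero\<close>. By continuity the tails of the given motion from these times on converge to the motion
  of \<open>(code zero, zero)\<close>, which therefore inherits an almost period \<open>\<tau>\<close>. Comparing it at times
  \<open>2 \<tau> - 1\<close> and \<open>\<tau> - 1\<close> contradicts \<open>parity_double\<close>.
\<close>

lemma not_almost_periodic:
  assumes y: "y \<in> dyadic"
  shows "\<not> almost_periodic_point (skew_product phi add_int) (u, y)"
proof
  let ?\<pi> = "skew_product phi add_int"
  assume "almost_periodic_point ?\<pi> (u, y)"
  \<comment> \<open>Any bound below the gap \<open>1/3\<close> of \<open>code_separates\<close> serves, as the limit preserves only \<open>\<le>\<close>.\<close>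
  then obtain l where "\<forall>a. \<exists>\<tau>\<in>{a..a + l}. \<forall>t. dist (?\<pi> (\<tau> + t) (u, y)) (?\<pi> t (u, y)) < 1/4"
    unfolding almost_periodic_point_def by (metis zero_less_divide_1_iff zero_less_numeral)
  then obtain \<tau> where "\<tau> \<in> {1..1 + l}"
    and ap: "\<And>t. dist (?\<pi> (\<tau> + t) (u, y)) (?\<pi> t (u, y)) < 1/4" by blast
  then have "\<tau> > 0" by simp
  have ap_phi: "\<bar>phi (\<tau> + t) u y - phi t u y\<bar> < 1/4" for t
    using le_less_trans[OF dist_fst_le ap[of t]] by (simp add: skew_product_def dist_real_def)
  \<comment> \<open>\<open>s k + 1\<close> is a time at which the base point is divisible by \<open>2 ^ k\<close>.\<close>
  define s where "s k = nat ((- 1 - \<lfloor>y k\<rfloor>) mod 2 ^ k)" for k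
  define z where "z k = add_int (int (Suc (s k))) y" for k
  define w where "w k = phi (Suc (s k)) u y" for k
  have z: "z k \<in> dyadic" for k using y by (simp add: z_def)
  have z0: "z k k = 0" for k
  proof -
    have "(\<lfloor>y k\<rfloor> + int (Suc (s k))) mod 2 ^ k
        = (\<lfloor>y k\<rfloor> + 1 + (- 1 - \<lfloor>y k\<rfloor>) mod 2 ^ k) mod 2 ^ k"
      by (simp add: s_def add_ac)
    also have "\<dots> = 0"
      unfolding mod_add_right_eq by simp
    finally show ?thesis by (simp add: z_def add_int_def)
  qed
  have "z \<longlonglongrightarrow> zero"
  proof (rule metric_LIMSEQ_I)
    fix e :: real assume "e > 0"
    then obtain n where n: "\<And>y z. y \<in> dyadic \<Longrightarrow> z \<in> dyadic \<Longrightarrow> y n = z n \<Longrightarrow> dist y z < e"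
      using dist_less_if_residue_eq by blast
    have "z k n = zero n" if "k \<ge> n" for k
      using dyadic_agree[OF z zero_dyadic _ that] z0 by (simp add: zero_def)
    then show "\<exists>N. \<forall>k\<ge>N. dist (z k) zero < e"
      using n z zero_dyadic by blast
  qed
  moreover have "w \<longlonglongrightarrow> code zero"
  proof -
    have "\<bar>w k - code zero\<bar> \<le> (1/3) ^ k" for k
    proof -
      have "\<bar>w k - code zero\<bar> \<le> radius (z k)"
        using clamped_dist[of "z k"] by (simp only: w_def phi_Suc) (simp add: z_def add.commute)
      then show ?thesis using radius_le[OF z z0] by (rule order_trans)
    qed
    then have "(\<lambda>k. w k - code zero) \<longlonglongrightarrow> 0"
      by (intro Lim_null_comparison[OF _ LIMSEQ_power_zero[of "1/3::real"]]) auto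
    then show ?thesis by (simp add: LIM_zero_iff)
  qed
  ultimately have "(\<lambda>k. (w k, z k)) \<longlonglongrightarrow> (code zero, zero)" by (intro tendsto_Pair)
  then have lim: "(\<lambda>k. phi t (w k) (z k)) \<longlonglongrightarrow> code (add_int (int t) zero)" for t
  proof -
    assume *: "(\<lambda>k. (w k, z k)) \<longlonglongrightarrow> (code zero, zero)"
    have "continuous_on (UNIV \<times> (UNIV \<times> dyadic)) (\<lambda>(t, x). ?\<pi> t x)"
      using skew_product_dynamical_system[OF dynamical_system_dyadic continuous_on_rhs]
      by (simp add: dynamical_system_def)
    then have "(\<lambda>k. (\<lambda>(t, x). ?\<pi> t x) (t, (w k, z k))) \<longlonglongrightarrow> (\<lambda>(t, x). ?\<pi> t x) (t, (code zero, zero))"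
      by (rule continuous_on_tendsto_compose) (use * z in \<open>auto intro!: tendsto_intros\<close>)
    then have "(\<lambda>k. fst (?\<pi> t (w k, z k))) \<longlonglongrightarrow> fst (?\<pi> t (code zero, zero))"
      by (auto intro: tendsto_fst)
    then show ?thesis by (simp add: skew_product_def phi_code)
  qed
  have tail: "phi t (w k) (z k) = phi (Suc (s k) + t) u y" for k t
    unfolding w_def z_def by (rule solution_cocycle[OF dynamical_system_dyadic y, symmetric])
  have "\<bar>code (add_int (int (\<tau> + t)) zero) - code (add_int (int t) zero)\<bar> \<le> 1/4" for t
  proof (rule tendsto_upperbound)
    show "(\<lambda>k. \<bar>phi (\<tau> + t) (w k) (z k) - phi t (w k) (z k)\<bar>)
        \<longlonglongrightarrow> \<bar>code (add_int (int (\<tau> + t)) zero) - code (add_int (int t) zero)\<bar>"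
      by (intro tendsto_intros lim)
    show "\<forall>\<^sub>F k in sequentially. \<bar>phi (\<tau> + t) (w k) (z k) - phi t (w k) (z k)\<bar> \<le> 1/4"
      unfolding tail using ap_phi[of "Suc (s _) + t"]
      by (auto intro!: always_eventually less_imp_le simp: add_ac simp del: solution.simps)
  qed simp
  from this[of "\<tau> - 1"]
  have "parity (add_int 1 (add_int (int (\<tau> + (\<tau> - 1))) zero))
      = parity (add_int 1 (add_int (int (\<tau> - 1)) zero))"
    by (intro code_separates) simp
  then have "parity (add_int (2 * int \<tau>) zero) = parity (add_int (int \<tau>) zero)"
    using \<open>\<tau> > 0\<close> by (simp add: add_int_add of_nat_diff)
  then show False
    using parity_double[of "int \<tau>"] parity_cases[of "add_int (int \<tau>) zero"] \<open>\<tau> > 0\<close> by auto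
qed

theorem mainTheorem1:
  "\<exists>(Y :: (nat \<Rightarrow> real) set) (\<sigma> :: int \<Rightarrow> (nat \<Rightarrow> real) \<Rightarrow> (nat \<Rightarrow> real))
      (F :: (nat \<Rightarrow> real) \<times> real \<Rightarrow> real).
     Y \<noteq> {} \<and> compact Y \<and> dynamical_system Y \<sigma> \<and> minimal_system Y \<sigma> \<and>
     (\<forall>y\<in>Y. almost_periodic_point \<sigma> y) \<and>
     continuous_on (Y \<times> UNIV) F \<and>
     compact_dissipative Y (solution F \<sigma>) \<and>
     dynamical_system (UNIV \<times> Y) (skew_product (solution F \<sigma>) \<sigma>) \<and>
     \<not> (\<exists>x \<in> UNIV \<times> Y. almost_periodic_point (skew_product (solution F \<sigma>) \<sigma>) x)"
proof (intro exI[of _ dyadic] exI[of _ add_int] exI[of _ rhs] conjI)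
  show "dyadic \<noteq> {}" using zero_dyadic by blast
  show "dynamical_system (UNIV \<times> dyadic) (skew_product phi add_int)"
    by (rule skew_product_dynamical_system[OF dynamical_system_dyadic continuous_on_rhs])
  show "\<not> (\<exists>x \<in> UNIV \<times> dyadic. almost_periodic_point (skew_product phi add_int) x)"
    using not_almost_periodic by auto
qed (use compact_dyadic dynamical_system_dyadic minimal_system_dyadic almost_periodic_point_dyadic
      continuous_on_rhs compact_dissipative_phi in blast)+

end
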